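(* Let $A$ be an MV-algebra and $I\subset A$ an ideal. Then $I$ is hyperradical if and only if it is both quasihyperradical and radical. (That is, an MV-algebra is semisimple and quasihyperarchimedean if and only if it is hyperarchimedean.)
   Context: In an MV-algebra $(A,\oplus,\neg,0)$ put $1=\neg 0$, $x\odot y=\neg(\neg x\oplus\neg y)$, $x\ominus y=x\odot\neg y$, $x\le y$ iff $x\ominus y=0$, and $na=a\oplus\cdots\oplus a$ ($n$ times, $0a=0$). An ideal is a subset containing $0$, closed under $\oplus$ and downward closed. For an ideal $I\subset A$: $\sqrt{I}=\{a\in A\mid na\ominus\neg a\in I\text{ for each integer }n\ge 0\}$. $Rad(I)$ is the intersection of all maximal ideals of $A$ containing $I$ (equal to $A$ if there are none), and $I$ is radical if $I=Rad(I)$. $I$ is hyperradical if for any $x\in A$ there is an integer $n\ge 1$ such that $(n+1)x\ominus nx\in I$. $I$ is quasihyperradical if for any $x\in A$ there is an integer $n\ge 1$ such that $(n+1)x\ominus nx\in\sqrt{I}$. $A$ is semisimple, hyperarchimedean, or quasihyperarchimedean if its ideal $\{0\}$ is radical, hyperradical, or quasihyperradical, respectively. *)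

theory Defs
  imports "HOL-Algebra.Congruence"
begin

record 'a mv = "'a partial_object" +
  mv_add :: "['a, 'a] \<Rightarrow> 'a" (infixl "\<oplus>\<index>" 65)
  mv_neg :: "'a \<Rightarrow> 'a" ("\<sim>\<index> _" [81] 80)
  mv_zero :: 'a ("\<zero>\<index>")

text \<open>The trivial algebra, in which \<open>0 = 1\<close>, is allowed.\<close>

locale mv_algebra =
  fixes A :: "('a, 'm) mv_scheme" (structure)
  assumes add_closed: "\<lbrakk>x \<in> carrier A; y \<in> carrier A\<rbrakk> \<Longrightarrow> x \<oplus> y \<in> carrier A"
    and neg_closed: "x \<in> carrier A \<Longrightarrow> \<sim> x \<in> carrier A"
    and zero_closed: "\<zero> \<in> carrier A"
    and add_assoc: "\<lbrakk>x \<in> carrier A; y \<in> carrier A; z \<in> carrier A\<rbrakk>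
          \<Longrightarrow> (x \<oplus> y) \<oplus> z = x \<oplus> (y \<oplus> z)"
    and add_commute: "\<lbrakk>x \<in> carrier A; y \<in> carrier A\<rbrakk> \<Longrightarrow> x \<oplus> y = y \<oplus> x"
    and add_zero: "x \<in> carrier A \<Longrightarrow> x \<oplus> \<zero> = x"
    and neg_neg: "x \<in> carrier A \<Longrightarrow> \<sim> (\<sim> x) = x"
    and add_neg_zero: "x \<in> carrier A \<Longrightarrow> x \<oplus> \<sim> \<zero> = \<sim> \<zero>"
    and lukasiewicz: "\<lbrakk>x \<in> carrier A; y \<in> carrier A\<rbrakk>
          \<Longrightarrow> \<sim> (\<sim> x \<oplus> y) \<oplus> y = \<sim> (\<sim> y \<oplus> x) \<oplus> x"

definition mv_times :: "('a, 'm) mv_scheme \<Rightarrow> 'a \<Rightarrow> 'a \<Rightarrow> 'a" (infixl "\<odot>\<index>" 70)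
  where "x \<odot>\<^bsub>A\<^esub> y = \<sim>\<^bsub>A\<^esub> (\<sim>\<^bsub>A\<^esub> x \<oplus>\<^bsub>A\<^esub> \<sim>\<^bsub>A\<^esub> y)"

definition mv_minus :: "('a, 'm) mv_scheme \<Rightarrow> 'a \<Rightarrow> 'a \<Rightarrow> 'a" (infixl "\<ominus>\<index>" 65)
  where "x \<ominus>\<^bsub>A\<^esub> y = x \<odot>\<^bsub>A\<^esub> \<sim>\<^bsub>A\<^esub> y"

definition mv_le :: "('a, 'm) mv_scheme \<Rightarrow> 'a \<Rightarrow> 'a \<Rightarrow> bool" (infix "\<preceq>\<index>" 50)
  where "x \<preceq>\<^bsub>A\<^esub> y \<longleftrightarrow> x \<ominus>\<^bsub>A\<^esub> y = \<zero>\<^bsub>A\<^esub>"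

primrec mv_nmult :: "('a, 'm) mv_scheme \<Rightarrow> nat \<Rightarrow> 'a \<Rightarrow> 'a"
  where
    "mv_nmult A 0 a = \<zero>\<^bsub>A\<^esub>"
  | "mv_nmult A (Suc n) a = mv_nmult A n a \<oplus>\<^bsub>A\<^esub> a"

text \<open>Ideals need not be proper; maximal ideals are.\<close>

definition mv_ideal :: "('a, 'm) mv_scheme \<Rightarrow> 'a set \<Rightarrow> bool"
  where "mv_ideal A I \<longleftrightarrow>
    I \<subseteq> carrier A \<and>
    \<zero>\<^bsub>A\<^esub> \<in> I \<and>
    (\<forall>x\<in>I. \<forall>y\<in>I. x \<oplus>\<^bsub>A\<^esub> y \<in> I) \<and>
    (\<forall>x\<in>carrier A. \<forall>y\<in>I. x \<preceq>\<^bsub>A\<^esub> y \<longrightarrow> x \<in> I)"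

definition mv_maximal_ideal :: "('a, 'm) mv_scheme \<Rightarrow> 'a set \<Rightarrow> bool"
  where "mv_maximal_ideal A M \<longleftrightarrow>
    mv_ideal A M \<and> M \<noteq> carrier A \<and>
    (\<forall>J. mv_ideal A J \<and> M \<subseteq> J \<longrightarrow> J = M \<or> J = carrier A)"

definition mv_sqrt :: "('a, 'm) mv_scheme \<Rightarrow> 'a set \<Rightarrow> 'a set"
  where "mv_sqrt A I =
    {a \<in> carrier A. \<forall>n::nat. mv_nmult A n a \<ominus>\<^bsub>A\<^esub> \<sim>\<^bsub>A\<^esub> a \<in> I}"

text \<open>Intersecting inside the carrier gives the whole algebra when no maximal ideal
  contains \<open>I\<close>.\<close>

definition mv_Rad :: "('a, 'm) mv_scheme \<Rightarrow> 'a set \<Rightarrow> 'a set"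
  where "mv_Rad A I = carrier A \<inter> \<Inter> {M. mv_maximal_ideal A M \<and> I \<subseteq> M}"

definition mv_radical :: "('a, 'm) mv_scheme \<Rightarrow> 'a set \<Rightarrow> bool"
  where "mv_radical A I \<longleftrightarrow> I = mv_Rad A I"

definition mv_hyperradical :: "('a, 'm) mv_scheme \<Rightarrow> 'a set \<Rightarrow> bool"
  where "mv_hyperradical A I \<longleftrightarrow>
    (\<forall>x\<in>carrier A. \<exists>n::nat. n \<ge> 1 \<and> mv_nmult A (n + 1) x \<ominus>\<^bsub>A\<^esub> mv_nmult A n x \<in> I)"

definition mv_quasihyperradical :: "('a, 'm) mv_scheme \<Rightarrow> 'a set \<Rightarrow> bool"
  where "mv_quasihyperradical A I \<longleftrightarrow>
    (\<forall>x\<in>carrier A. \<exists>n::nat. n \<ge> 1 \<and>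
      mv_nmult A (n + 1) x \<ominus>\<^bsub>A\<^esub> mv_nmult A n x \<in> mv_sqrt A I)"

definition mv_semisimple :: "('a, 'm) mv_scheme \<Rightarrow> bool"
  where "mv_semisimple A \<longleftrightarrow> mv_radical A {\<zero>\<^bsub>A\<^esub>}"

definition mv_hyperarchimedean :: "('a, 'm) mv_scheme \<Rightarrow> bool"
  where "mv_hyperarchimedean A \<longleftrightarrow> mv_hyperradical A {\<zero>\<^bsub>A\<^esub>}"

definition mv_quasihyperarchimedean :: "('a, 'm) mv_scheme \<Rightarrow> bool"
  where "mv_quasihyperarchimedean A \<longleftrightarrow> mv_quasihyperradical A {\<zero>\<^bsub>A\<^esub>}"

end

theory Submission
  imports Defs
begin

text \<open>
  Both directions compare \<open>I\<close> with the ideal generated by \<open>I\<close> and a single element \<open>c\<close>, which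
  consists of the elements below some \<open>i \<oplus> kc\<close> with \<open>i \<in> I\<close>.

  If \<open>I\<close> is hyperradical and \<open>a \<notin> I\<close>, choose \<open>n\<close> with
  \<open>(n+1)a \<ominus> na = a \<and> \<not>na \<in> I\<close>. The ideal generated by \<open>I\<close> and \<open>\<not>na\<close> is proper, for
  \<open>a \<le> i \<oplus> k\<not>na\<close> would give \<open>a \<le> i \<oplus> k(a \<and> \<not>na) \<in> I\<close>. A maximal ideal above it contains
  \<open>\<not>na\<close> and hence misses \<open>a\<close>, so \<open>a \<notin> Rad(I)\<close>.

  Conversely \<open>\<surd>I \<subseteq> Rad(I)\<close> for every ideal \<open>I\<close>: if \<open>a \<in> \<surd>I\<close> and \<open>M \<supseteq> I\<close> is maximal with
  \<open>a \<notin> M\<close>, then \<open>1 = m \<oplus> na\<close> for some \<open>m \<in> M\<close>, so \<open>\<not>na \<le> m\<close> and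
  \<open>a \<le> (na \<odot> a) \<oplus> \<not>na \<in> M\<close>, a contradiction.
\<close>

context mv_algebra
begin

section \<open>Arithmetic and order in an MV-algebra\<close>

lemmas closed [simp] = add_closed neg_closed zero_closed

lemma minus_eq: "\<lbrakk>x \<in> carrier A; y \<in> carrier A\<rbrakk> \<Longrightarrow> x \<ominus> y = \<sim> (\<sim> x \<oplus> y)"
  by (simp add: mv_minus_def mv_times_def neg_neg)

lemma minus_closed [simp]: "\<lbrakk>x \<in> carrier A; y \<in> carrier A\<rbrakk> \<Longrightarrow> x \<ominus> y \<in> carrier A"
  by (simp add: minus_eq)

lemma nmult_closed [simp]: "x \<in> carrier A \<Longrightarrow> mv_nmult A n x \<in> carrier A"
  by (induction n) auto

lemma add_left_commute:
  "\<lbrakk>x \<in> carrier A; y \<in> carrier A; z \<in> carrier A\<rbrakk> \<Longrightarrow> x \<oplus> (y \<oplus> z) = y \<oplus> (x \<oplus> z)"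
  by (metis add_assoc add_commute)

lemmas add_ac = add_assoc add_commute add_left_commute

lemma zero_add: "x \<in> carrier A \<Longrightarrow> \<zero> \<oplus> x = x"
  by (metis add_commute add_zero zero_closed)

text \<open>The axiom \<open>lukasiewicz\<close> with \<open>\<sim> \<zero>\<close> as second
  argument: its left side collapses to \<open>\<sim> \<zero>\<close>, its right side to
  \<open>\<sim> x \<oplus> x\<close>.\<close>

lemma neg_add_self: "x \<in> carrier A \<Longrightarrow> \<sim> x \<oplus> x = \<sim> \<zero>"
  using lukasiewicz[of x "\<sim> \<zero>"] by (simp add: add_neg_zero neg_neg zero_add)

lemma le_iff: "\<lbrakk>x \<in> carrier A; y \<in> carrier A\<rbrakk> \<Longrightarrow> x \<preceq> y \<longleftrightarrow> \<sim> x \<oplus> y = \<sim> \<zero>"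
  by (metis mv_le_def minus_eq neg_neg closed)

lemma le_add_left: "\<lbrakk>x \<in> carrier A; y \<in> carrier A\<rbrakk> \<Longrightarrow> x \<preceq> x \<oplus> y"
  by (simp add: le_iff add_assoc[symmetric] neg_add_self)
    (metis add_commute add_neg_zero closed(2,3))

lemma le_add_right: "\<lbrakk>x \<in> carrier A; y \<in> carrier A\<rbrakk> \<Longrightarrow> y \<preceq> x \<oplus> y"
  by (metis le_add_left add_commute)

lemma le_refl: "x \<in> carrier A \<Longrightarrow> x \<preceq> x"
  by (simp add: le_iff neg_add_self)

text \<open>This is the axiom \<open>lukasiewicz\<close> rewritten;
  \<open>(x \<ominus> y) \<oplus> y\<close> is the join of \<open>x\<close> and \<open>y\<close>, so
  the axiom expresses the symmetry of the join.\<close>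

lemma minus_add_commute:
  "\<lbrakk>x \<in> carrier A; y \<in> carrier A\<rbrakk> \<Longrightarrow> (x \<ominus> y) \<oplus> y = (y \<ominus> x) \<oplus> x"
  by (simp add: minus_eq lukasiewicz)

lemma le_minus_add: "\<lbrakk>x \<in> carrier A; y \<in> carrier A; x \<preceq> y\<rbrakk> \<Longrightarrow> (y \<ominus> x) \<oplus> x = y"
  using minus_add_commute[of x y] by (simp add: mv_le_def zero_add)

text \<open>Two applications of \<open>le_minus_add\<close> exhibit \<open>x\<close> as a summand of
  \<open>z\<close>, and a summand lies below the sum.\<close>

lemma le_trans:
  assumes "x \<in> carrier A" "y \<in> carrier A" "z \<in> carrier A" "x \<preceq> y" "y \<preceq> z"
  shows "x \<preceq> z"
proof -
  have "z = ((z \<ominus> y) \<oplus> (y \<ominus> x)) \<oplus> x"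
    using assms by (simp add: le_minus_add add_assoc)
  then show ?thesis
    using assms le_add_right[of "(z \<ominus> y) \<oplus> (y \<ominus> x)" x] by simp
qed

lemma add_mono:
  assumes "x \<in> carrier A" "y \<in> carrier A" "u \<in> carrier A" "v \<in> carrier A" "x \<preceq> u" "y \<preceq> v"
  shows "x \<oplus> y \<preceq> u \<oplus> v"
proof -
  have "u \<oplus> v = ((u \<ominus> x) \<oplus> x) \<oplus> ((v \<ominus> y) \<oplus> y)"
    using assms by (simp add: le_minus_add)
  also have "\<dots> = (x \<oplus> y) \<oplus> ((u \<ominus> x) \<oplus> (v \<ominus> y))"
    using assms by (simp add: add_ac)
  finally show ?thesis
    using assms by (simp add: le_add_left)
qed

text \<open>Residuation: both sides unfold to
  \<open>\<sim> x \<oplus> (y \<oplus> z) = \<sim> \<zero>\<close>.\<close>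

lemma minus_le_iff:
  "\<lbrakk>x \<in> carrier A; y \<in> carrier A; z \<in> carrier A\<rbrakk> \<Longrightarrow> x \<ominus> y \<preceq> z \<longleftrightarrow> x \<preceq> y \<oplus> z"
  by (simp add: le_iff minus_eq neg_neg add_assoc)

lemma le_neg_swap: "\<lbrakk>x \<in> carrier A; y \<in> carrier A; x \<preceq> \<sim> y\<rbrakk> \<Longrightarrow> y \<preceq> \<sim> x"
  by (simp add: le_iff add_commute)

lemma neg_antimono: "\<lbrakk>x \<in> carrier A; y \<in> carrier A; x \<preceq> y\<rbrakk> \<Longrightarrow> \<sim> y \<preceq> \<sim> x"
  by (simp add: le_iff neg_neg add_commute)

lemma le_minus_add_self: "\<lbrakk>x \<in> carrier A; y \<in> carrier A\<rbrakk> \<Longrightarrow> x \<preceq> (x \<ominus> y) \<oplus> y"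
  by (metis minus_add_commute le_add_right minus_closed)

lemma le_neg_zero: "x \<in> carrier A \<Longrightarrow> x \<preceq> \<sim> \<zero>"
  by (simp add: le_iff add_neg_zero)

lemma minus_le: "\<lbrakk>x \<in> carrier A; y \<in> carrier A\<rbrakk> \<Longrightarrow> x \<ominus> y \<preceq> x"
  by (simp add: minus_le_iff le_add_right)

text \<open>Together with \<open>le_minus_add_self\<close> and \<open>le_add_right\<close> this
  identifies \<open>(x \<ominus> y) \<oplus> y\<close> as the least upper bound of \<open>x\<close>
  and \<open>y\<close>.\<close>

lemma minus_add_least:
  assumes "x \<in> carrier A" "y \<in> carrier A" "z \<in> carrier A" "x \<preceq> z" "y \<preceq> z"
  shows "(x \<ominus> y) \<oplus> y \<preceq> z"
proof -
  have "x \<ominus> y \<preceq> z \<ominus> y"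
    using assms le_minus_add[of y z] by (simp add: minus_le_iff add_commute)
  then have "(x \<ominus> y) \<oplus> y \<preceq> (z \<ominus> y) \<oplus> y"
    using assms by (intro add_mono) (auto simp: le_refl)
  then show ?thesis
    using assms by (simp add: le_minus_add)
qed

text \<open>The element \<open>(y \<oplus> x) \<ominus> y\<close> is the meet of \<open>x\<close> and \<open>\<sim> y\<close>.\<close>

lemma le_add_minusI:
  assumes [simp]: "x \<in> carrier A" "y \<in> carrier A" "z \<in> carrier A"
    and "z \<preceq> x" "z \<preceq> \<sim> y"
  shows "z \<preceq> (y \<oplus> x) \<ominus> y"
proof -
  \<comment> \<open>De Morgan: the meet of \<open>x\<close> and \<open>\<sim> y\<close> is the
    negation of the join of \<open>\<sim> x\<close> and \<open>y\<close>.\<close>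
  have "(\<sim> x \<ominus> y) \<oplus> y \<preceq> \<sim> z"
    by (rule minus_add_least) (simp_all add: assms neg_antimono le_neg_swap)
  then have "z \<preceq> \<sim> ((\<sim> x \<ominus> y) \<oplus> y)"
    by (rule le_neg_swap[rotated 2]) simp_all
  also have "\<sim> ((\<sim> x \<ominus> y) \<oplus> y) = (y \<oplus> x) \<ominus> y"
    by (simp add: minus_eq neg_neg add_commute)
  finally show ?thesis .
qed

lemma nmult_add:
  "x \<in> carrier A \<Longrightarrow> mv_nmult A (m + n) x = mv_nmult A m x \<oplus> mv_nmult A n x"
  by (induction n) (auto simp: add_zero add_assoc)

section \<open>Ideals\<close>

lemma ideal_subset: "\<lbrakk>mv_ideal A I; x \<in> I\<rbrakk> \<Longrightarrow> x \<in> carrier A"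
  by (auto simp: mv_ideal_def)

lemma ideal_zero: "mv_ideal A I \<Longrightarrow> \<zero> \<in> I"
  by (simp add: mv_ideal_def)

lemma ideal_add: "\<lbrakk>mv_ideal A I; x \<in> I; y \<in> I\<rbrakk> \<Longrightarrow> x \<oplus> y \<in> I"
  by (simp add: mv_ideal_def)

lemma ideal_down: "\<lbrakk>mv_ideal A I; y \<in> I; x \<in> carrier A; x \<preceq> y\<rbrakk> \<Longrightarrow> x \<in> I"
  by (auto simp: mv_ideal_def)

lemma ideal_nmult: "\<lbrakk>mv_ideal A I; x \<in> I\<rbrakk> \<Longrightarrow> mv_nmult A n x \<in> I"
  by (induction n) (auto simp: ideal_zero ideal_add)

lemma ideal_eq_carrier_iff: "mv_ideal A I \<Longrightarrow> I = carrier A \<longleftrightarrow> \<sim> \<zero> \<in> I"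
  by (auto simp: le_neg_zero ideal_subset intro: ideal_down[of I "\<sim> \<zero>"])

lemma ideal_singleton_zero: "mv_ideal A {\<zero>}"
proof -
  have "x = \<zero>" if "x \<in> carrier A" "x \<preceq> \<zero>" for x
    using that by (metis add_zero le_iff neg_closed neg_neg zero_closed)
  then show ?thesis
    by (auto simp: mv_ideal_def add_zero)
qed

section \<open>The ideal generated by an ideal and one element\<close>

definition ideal_adjoin :: "'a set \<Rightarrow> 'a \<Rightarrow> 'a set"
  where "ideal_adjoin I c = {x \<in> carrier A. \<exists>i\<in>I. \<exists>k. x \<preceq> i \<oplus> mv_nmult A k c}"

lemma ideal_adjoinI:
  "\<lbrakk>x \<in> carrier A; i \<in> I; x \<preceq> i \<oplus> mv_nmult A k c\<rbrakk> \<Longrightarrow> x \<in> ideal_adjoin I c"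
  unfolding ideal_adjoin_def by blast

lemma ideal_adjoin_ideal:
  assumes I: "mv_ideal A I" and c: "c \<in> carrier A"
  shows "mv_ideal A (ideal_adjoin I c)"
  unfolding mv_ideal_def
proof (intro conjI ballI impI)
  show "ideal_adjoin I c \<subseteq> carrier A"
    by (auto simp: ideal_adjoin_def)
  show "\<zero> \<in> ideal_adjoin I c"
    using ideal_zero[OF I] c by (intro ideal_adjoinI[of _ \<zero>] le_add_left) simp_all
next
  fix x y assume "x \<in> ideal_adjoin I c" "y \<in> ideal_adjoin I c"
  then obtain i j k l where ij: "x \<in> carrier A" "y \<in> carrier A" "i \<in> I" "j \<in> I"
    and le: "x \<preceq> i \<oplus> mv_nmult A k c" "y \<preceq> j \<oplus> mv_nmult A l c"
    unfolding ideal_adjoin_def by blast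
  note [simp] = c ij(1,2) ideal_subset[OF I ij(3)] ideal_subset[OF I ij(4)]
  have "x \<oplus> y \<preceq> (i \<oplus> mv_nmult A k c) \<oplus> (j \<oplus> mv_nmult A l c)"
    using le by (intro add_mono) auto
  also have "\<dots> = (i \<oplus> j) \<oplus> mv_nmult A (k + l) c"
    by (simp add: nmult_add add_ac)
  finally show "x \<oplus> y \<in> ideal_adjoin I c"
    using ideal_add[OF I ij(3,4)] by (intro ideal_adjoinI) simp_all
next
  fix x y assume x: "x \<in> carrier A" and le: "x \<preceq> y"
    and "y \<in> ideal_adjoin I c"
  from this(3) obtain i k where y: "y \<in> carrier A" "i \<in> I" "y \<preceq> i \<oplus> mv_nmult A k c"
    unfolding ideal_adjoin_def by blast
  then have "x \<preceq> i \<oplus> mv_nmult A k c"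
    using le_trans[OF x y(1) _ le] ideal_subset[OF I] c by simp
  with x y(2) show "x \<in> ideal_adjoin I c"
    by (rule ideal_adjoinI)
qed

lemma subset_ideal_adjoin:
  assumes "mv_ideal A I" "c \<in> carrier A"
  shows "I \<subseteq> ideal_adjoin I c"
  using assms ideal_subset by (auto intro!: ideal_adjoinI le_add_left)

lemma mem_ideal_adjoin:
  assumes "mv_ideal A I" "c \<in> carrier A"
  shows "c \<in> ideal_adjoin I c"
proof -
  have "c \<preceq> \<zero> \<oplus> mv_nmult A 1 c"
    using assms by (simp add: zero_add le_refl)
  then show ?thesis
    using assms ideal_zero by (intro ideal_adjoinI)
qed

text \<open>Each copy of \<open>\<sim> y\<close> in the bound can be traded for the meet of
  \<open>x\<close> and \<open>\<sim> y\<close>, which lies in \<open>I\<close>. Induction on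
  \<open>k\<close> removes all copies; \<open>i\<close> is arbitrary because it absorbs one meet per
  step.\<close>

lemma mem_ideal_if_le_add_nmult:
  assumes I: "mv_ideal A I" and [simp]: "x \<in> carrier A" "y \<in> carrier A"
    and meet: "(y \<oplus> x) \<ominus> y \<in> I"
    and "i \<in> I" "x \<preceq> i \<oplus> mv_nmult A k (\<sim> y)"
  shows "x \<in> I"
  using assms(5,6)
proof (induction k arbitrary: i)
  case 0
  then have "x \<preceq> i"
    using ideal_subset[OF I] by (simp add: add_zero)
  then show ?case
    using 0 ideal_down[OF I] by simp
next
  case (Suc k)
  define b where "b = i \<oplus> mv_nmult A k (\<sim> y)"
  note [simp] = ideal_subset[OF I Suc.prems(1)] ideal_subset[OF I meet]
  have b [simp]: "b \<in> carrier A"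
    by (simp add: b_def)
  have "x \<preceq> b \<oplus> \<sim> y"
    using Suc.prems by (simp add: b_def add_assoc)
  then have "x \<ominus> b \<preceq> \<sim> y"
    by (simp add: minus_le_iff)
  \<comment> \<open>The difference lies below \<open>x\<close> as well as below
    \<open>\<sim> y\<close>, hence below their meet.\<close>
  then have "x \<ominus> b \<preceq> (y \<oplus> x) \<ominus> y"
    by (intro le_add_minusI) (auto simp: minus_le)
  then have "x \<preceq> b \<oplus> ((y \<oplus> x) \<ominus> y)"
    by (simp add: minus_le_iff)
  also have "\<dots> = (i \<oplus> ((y \<oplus> x) \<ominus> y)) \<oplus> mv_nmult A k (\<sim> y)"
    by (simp add: b_def add_ac)
  finally show ?case
    using Suc.IH ideal_add[OF I Suc.prems(1) meet] by blast
qed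

section \<open>Existence of maximal ideals\<close>

lemma exists_maximal_ideal:
  assumes I: "mv_ideal A I" and proper: "\<sim> \<zero> \<notin> I"
  shows "\<exists>M. mv_maximal_ideal A M \<and> I \<subseteq> M"
proof -
  \<comment> \<open>Properness is expressed by omitting \<open>\<sim> \<zero>\<close>, a condition
    that passes to unions of chains, so Zorn's lemma applies.\<close>
  define F where "F = {J. mv_ideal A J \<and> I \<subseteq> J \<and> \<sim> \<zero> \<notin> J}"
  have "\<exists>M\<in>F. \<forall>J\<in>F. M \<subseteq> J \<longrightarrow> J = M"
  proof (rule subset_Zorn_nonempty)
    show "F \<noteq> {}"
      using assms unfolding F_def by blast
  next
    fix C assume "C \<noteq> {}" and C: "subset.chain F C"
    then have CF: "\<And>J. J \<in> C \<Longrightarrow> J \<in> F" and lin: "\<And>J K. \<lbrakk>J \<in> C; K \<in> C\<rbrakk> \<Longrightarrow> J \<subseteq> K \<or> K \<subseteq> J"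
      by (auto simp: subset_chain_def)
    have id: "\<And>J. J \<in> C \<Longrightarrow> mv_ideal A J"
      using CF by (auto simp: F_def)
    have "mv_ideal A (\<Union>C)"
      unfolding mv_ideal_def
    proof (intro conjI ballI impI)
      show "\<Union>C \<subseteq> carrier A"
        using id ideal_subset by blast
      show "\<zero> \<in> \<Union>C"
        using id ideal_zero \<open>C \<noteq> {}\<close> by blast
      show "x \<oplus> y \<in> \<Union>C" if xy: "x \<in> \<Union>C" "y \<in> \<Union>C" for x y
      proof -
        obtain J K where "J \<in> C" "K \<in> C" "x \<in> J" "y \<in> K"
          using xy by blast
        \<comment> \<open>One of \<open>J\<close> and \<open>K\<close> contains the other, so their
          union is the larger of the two.\<close>
        then have "J \<union> K \<in> C" "x \<in> J \<union> K" "y \<in> J \<union> K"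
          using lin[of J K] by (auto simp: Un_absorb1 Un_absorb2)
        then show ?thesis
          using ideal_add[OF id] by blast
      qed
      show "x \<in> \<Union>C" if "x \<in> carrier A" "y \<in> \<Union>C" "x \<preceq> y" for x y
        using that id ideal_down by blast
    qed
    moreover have "I \<subseteq> \<Union>C" "\<sim> \<zero> \<notin> \<Union>C"
      using CF \<open>C \<noteq> {}\<close> by (auto simp: F_def)
    ultimately show "\<Union>C \<in> F"
      by (simp add: F_def)
  qed
  then obtain M where M: "M \<in> F" and max: "\<And>J. \<lbrakk>J \<in> F; M \<subseteq> J\<rbrakk> \<Longrightarrow> J = M"
    by blast
  have "J = M \<or> J = carrier A" if "mv_ideal A J" "M \<subseteq> J" for J
    using max[of J] that M ideal_eq_carrier_iff[of J] by (auto simp: F_def)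
  then have "mv_maximal_ideal A M"
    using M ideal_eq_carrier_iff[of M] by (auto simp: F_def mv_maximal_ideal_def)
  then show ?thesis
    using M by (auto simp: F_def)
qed

section \<open>The square root and the radical of an ideal\<close>

lemma ideal_subset_sqrt:
  assumes I: "mv_ideal A I"
  shows "I \<subseteq> mv_sqrt A I"
proof
  fix a assume a: "a \<in> I"
  note [simp] = ideal_subset[OF I a]
  have "mv_nmult A n a \<ominus> \<sim> a \<in> I" for n
    by (rule ideal_down[OF I ideal_nmult[OF I a, of n]]) (auto simp: minus_le)
  then show "a \<in> mv_sqrt A I"
    by (simp add: mv_sqrt_def)
qed

lemma ideal_subset_Rad: "mv_ideal A I \<Longrightarrow> I \<subseteq> mv_Rad A I"
  by (auto simp: mv_Rad_def ideal_subset)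

lemma sqrt_subset_Rad: "mv_sqrt A I \<subseteq> mv_Rad A I"
proof
  fix a assume "a \<in> mv_sqrt A I"
  then have a [simp]: "a \<in> carrier A" and sq: "\<And>n. mv_nmult A n a \<ominus> \<sim> a \<in> I"
    by (auto simp: mv_sqrt_def)
  have "a \<in> M" if max: "mv_maximal_ideal A M" and "I \<subseteq> M" for M
  proof (rule ccontr)
    assume "a \<notin> M"
    have M: "mv_ideal A M"
      using max by (simp add: mv_maximal_ideal_def)
    \<comment> \<open>Adjoining \<open>a\<close> enlarges \<open>M\<close> strictly, so maximality
      leaves only the whole algebra.\<close>
    have "ideal_adjoin M a = carrier A"
      using max ideal_adjoin_ideal[OF M a] subset_ideal_adjoin[OF M a] mem_ideal_adjoin[OF M a]
        \<open>a \<notin> M\<close> unfolding mv_maximal_ideal_def by blast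
    then obtain m n where m: "m \<in> M" and le: "\<sim> \<zero> \<preceq> m \<oplus> mv_nmult A n a"
      using closed(2)[OF zero_closed] unfolding ideal_adjoin_def by blast
    define y where "y = mv_nmult A n a"
    have y [simp]: "y \<in> carrier A" and [simp]: "m \<in> carrier A"
      using ideal_subset[OF M m] by (auto simp: y_def)
    have "\<sim> y \<preceq> m"
      using le by (simp add: le_iff neg_neg zero_add add_commute y_def)
    then have "\<sim> y \<in> M"
      using ideal_down[OF M m] by simp
    moreover have "y \<ominus> \<sim> a \<in> M"
      using sq \<open>I \<subseteq> M\<close> by (auto simp: y_def)
    ultimately have "(y \<ominus> \<sim> a) \<oplus> \<sim> y \<in> M"
      by (simp add: ideal_add[OF M])
    \<comment> \<open>By commutativity \<open>a \<ominus> \<sim> y\<close> and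
      \<open>y \<ominus> \<sim> a\<close> are the same product \<open>a \<odot> y\<close>. The sum
      is therefore the join of \<open>a\<close> and \<open>\<sim> y\<close>, which bounds
      \<open>a\<close>.\<close>
    moreover have "(a \<ominus> \<sim> y) \<oplus> \<sim> y = (y \<ominus> \<sim> a) \<oplus> \<sim> y"
      by (simp add: minus_eq add_commute)
    ultimately have "a \<in> M"
      using le_minus_add_self[of a "\<sim> y"] ideal_down[OF M] by simp
    with \<open>a \<notin> M\<close> show False by simp
  qed
  then show "a \<in> mv_Rad A I"
    by (auto simp: mv_Rad_def)
qed

section \<open>Hyperradical ideals\<close>

lemma hyperradical_imp_radical:
  assumes I: "mv_ideal A I" and hyper: "mv_hyperradical A I"
  shows "mv_radical A I"
proof -
  have "a \<in> I" if "a \<in> mv_Rad A I" for a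
  proof (rule ccontr)
    assume "a \<notin> I"
    have [simp]: "a \<in> carrier A" and rad: "\<And>M. \<lbrakk>mv_maximal_ideal A M; I \<subseteq> M\<rbrakk> \<Longrightarrow> a \<in> M"
      using that by (auto simp: mv_Rad_def)
    obtain n where n: "mv_nmult A (n + 1) a \<ominus> mv_nmult A n a \<in> I"
      using hyper unfolding mv_hyperradical_def by fastforce
    define y where "y = mv_nmult A n a"
    \<comment> \<open>Since \<open>mv_nmult A (n + 1) a\<close> unfolds to
      \<open>y \<oplus> a\<close>, the element given by hyperradicality is the meet of
      \<open>a\<close> and \<open>\<sim> y\<close>.\<close>
    have y [simp]: "y \<in> carrier A" and meet: "(y \<oplus> a) \<ominus> y \<in> I"
      using n by (auto simp: y_def)
    define J where "J = ideal_adjoin I (\<sim> y)"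
    have J: "mv_ideal A J" "I \<subseteq> J" "\<sim> y \<in> J"
      unfolding J_def by (simp_all add: I ideal_adjoin_ideal subset_ideal_adjoin mem_ideal_adjoin)
    have "a \<notin> J"
      using mem_ideal_if_le_add_nmult[OF I _ y meet] \<open>a \<notin> I\<close> unfolding J_def ideal_adjoin_def
      by auto
    then have "\<sim> \<zero> \<notin> J"
      using ideal_eq_carrier_iff[OF J(1)] by auto
    then obtain M where max: "mv_maximal_ideal A M" and "J \<subseteq> M"
      using exists_maximal_ideal[OF J(1)] by blast
    then have M: "mv_ideal A M" "M \<noteq> carrier A"
      by (auto simp: mv_maximal_ideal_def)
    have "a \<in> M"
      using rad[OF max] J(2) \<open>J \<subseteq> M\<close> by blast
    \<comment> \<open>\<open>M\<close> contains \<open>a\<close>, hence its multiple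
      \<open>y\<close>, and contains \<open>\<sim> y\<close> through \<open>J\<close>; their sum is
      \<open>\<sim> \<zero>\<close>.\<close>
    then have "\<sim> y \<oplus> y \<in> M"
      using J(3) \<open>J \<subseteq> M\<close> M(1) by (auto simp: y_def intro!: ideal_add ideal_nmult)
    then show False
      using M ideal_eq_carrier_iff by (simp add: neg_add_self)
  qed
  then show ?thesis
    using ideal_subset_Rad[OF I] by (auto simp: mv_radical_def)
qed

lemma hyperradical_iff:
  assumes I: "mv_ideal A I"
  shows "mv_hyperradical A I \<longleftrightarrow> mv_quasihyperradical A I \<and> mv_radical A I"
proof
  assume "mv_hyperradical A I"
  moreover from this have "mv_quasihyperradical A I"
    using ideal_subset_sqrt[OF I] unfolding mv_hyperradical_def mv_quasihyperradical_def
    by (meson subsetD)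
  ultimately show "mv_quasihyperradical A I \<and> mv_radical A I"
    using hyperradical_imp_radical[OF I] by blast
next
  assume "mv_quasihyperradical A I \<and> mv_radical A I"
  \<comment> \<open>Radicality turns the inclusion into \<open>mv_sqrt A I \<subseteq> I\<close>, so
    the same \<open>n\<close> serves.\<close>
  then show "mv_hyperradical A I"
    using sqrt_subset_Rad[of I]
    unfolding mv_hyperradical_def mv_quasihyperradical_def mv_radical_def by (metis subsetD)
qed

end

theorem proposition4p5:
  fixes A :: "('a, 'm) mv_scheme"
  assumes "mv_algebra A"
  shows "(\<forall>I. mv_ideal A I \<longrightarrow>
            (mv_hyperradical A I \<longleftrightarrow> mv_quasihyperradical A I \<and> mv_radical A I))
       \<and> (mv_semisimple A \<and> mv_quasihyperarchimedean A \<longleftrightarrow> mv_hyperarchimedean A)"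
proof -
  interpret mv_algebra A by fact
  show ?thesis
    \<comment> \<open>The second claim is the first for the ideal \<open>{\<zero>}\<close>.\<close>
    by (auto simp: mv_semisimple_def mv_hyperarchimedean_def mv_quasihyperarchimedean_def
        hyperradical_iff ideal_singleton_zero)
qed

end
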